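(* Suppose the regularity assumption holds with constant $L>0$, $\mathcal X$ satisfies the $\alpha$-Riemannian scaling inequality for some $\alpha>0$, and $$\nu:=\inf_{x\in\mathcal X}\|\operatorname{grad}f(x)\|_x>0.$$ Let $M_{\rm RSI}:=L/(\alpha\nu)$. Then for every $x\in\mathcal X$, every $v\in\mathcal S(x)$, and every $\eta\in[0,1]$, $$g(x)\ge\alpha\nu\|v\|_x^2,$$ $$f(\operatorname{Exp}_x(\eta v))-f(x)-\eta\langle\operatorname{grad}f(x),v\rangle_x\le\frac{M_{\rm RSI}}{2}\eta^2g(x).$$
   Context: Setting. $\mathcal M$ is a connected, complete, finite-dimensional Riemannian manifold with distance $d$, tangent spaces $T_x\mathcal M$, inner products $\langle\cdot,\cdot\rangle_x$, norms $\|\cdot\|_x$ and exponential map $\operatorname{Exp}_x$. The set $\mathcal X\subset\mathcal M$ is nonempty and compact, with positive diameter, and is weakly minimizing-geodesically convex: for all $x,y\in\mathcal X$ there is at least one distance-minimizing geodesic from $x$ to $y$ whose image is contained in $\mathcal X$. For $x\in\mathcal X$ the set of feasible minimizing initial velocities is $$\mathcal V(x):=\{v\in T_x\mathcal M:\ \operatorname{Exp}_x(v)\in\mathcal X,\ \|v\|_x=d(x,\operatorname{Exp}_x(v)),\ \operatorname{Exp}_x(tv)\in\mathcal X\ \text{for all }t\in[0,1]\}.$$ The function $f$ is real-valued and differentiable on an open neighborhood of $\mathcal X$, with Riemannian gradient $\operatorname{grad}f$. Regularity assumption (constant $L>0$): for all $x\in\mathcal X$, $v\in\mathcal V(x)$,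 $t\in[0,1]$, $f(\operatorname{Exp}_x(tv))\le(1-t)f(x)+tf(\operatorname{Exp}_x(v))$ and $f(\operatorname{Exp}_x(tv))\le f(x)+t\langle\operatorname{grad}f(x),v\rangle_x+\frac L2t^2\|v\|_x^2$. Oracle. $\mathcal S(x):=\arg\min_{v\in\mathcal V(x)}\langle\operatorname{grad}f(x),v\rangle_x$ (the set of exact oracle solutions) and $g(x):=-\min_{v\in\mathcal V(x)}\langle\operatorname{grad}f(x),v\rangle_x$. $\alpha$-Riemannian scaling inequality (RSI): for all $x\in\mathcal X$, $w\in T_x\mathcal M$ and $v\in\mathcal A(x,w):=\arg\max_{u\in\mathcal V(x)}\langle w,u\rangle_x$, one has $\langle w,v\rangle_x\ge\alpha\|w\|_x\|v\|_x^2$. *)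

theory Defs
  imports "HOL-Analysis.Analysis"
begin

section \<open>Smooth maps between Euclidean spaces\<close>

text \<open>For an open subset \<open>S\<close> of a Euclidean space, \<open>C_k_on k S f\<close> says that \<open>f\<close> is of class
  \<open>C\<^sup>k\<close> on \<open>S\<close>, expressed through its directional derivatives.\<close>

primrec C_k_on :: "nat \<Rightarrow> 'e::euclidean_space set \<Rightarrow> ('e \<Rightarrow> 'b::real_normed_vector) \<Rightarrow> bool" where
  "C_k_on 0 S f \<longleftrightarrow> continuous_on S f"
| "C_k_on (Suc k) S f \<longleftrightarrow>
     (\<forall>x\<in>S. f differentiable (at x)) \<and> (\<forall>v. C_k_on k S (\<lambda>x. frechet_derivative f (at x) v))"

definition smooth_on :: "'e::euclidean_space set \<Rightarrow> ('e \<Rightarrow> 'b::real_normed_vector) \<Rightarrow> bool" where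
  "smooth_on S f \<longleftrightarrow> (\<forall>k. C_k_on k S f)"


section \<open>Smooth manifolds and tangent vectors\<close>

text \<open>The manifold is the whole type \<open>'a\<close>; its dimension is that of the Euclidean model space
  \<open>'e\<close>. A chart is a pair of a domain and a coordinate map, the latter being meaningful only on
  the domain. The dimension 0 is not covered, as \<open>DIM('e) \<ge> 1\<close> for every Euclidean space; a
  connected 0-dimensional manifold is a single point and has no subset of positive diameter.\<close>

type_synonym ('a, 'e) chart = "'a set \<times> ('a \<Rightarrow> 'e)"

definition chart_inv :: "('a, 'e) chart \<Rightarrow> 'e \<Rightarrow> 'a" where
  "chart_inv c = inv_into (fst c) (snd c)"

definition transition :: "('a, 'e) chart \<Rightarrow> ('a, 'e) chart \<Rightarrow> 'e \<Rightarrow> 'e" where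
  "transition c c' = snd c' \<circ> chart_inv c"

definition charts_at :: "('a, 'e) chart set \<Rightarrow> 'a \<Rightarrow> ('a, 'e) chart set" where
  "charts_at A x = {c \<in> A. x \<in> fst c}"

definition smooth_atlas ::
  "('a::{t2_space, second_countable_topology}, 'e::euclidean_space) chart set \<Rightarrow> bool" where
  "smooth_atlas A \<longleftrightarrow>
     (\<Union>c\<in>A. fst c) = UNIV \<and>
     (\<forall>c\<in>A. open (fst c) \<and> open (snd c ` fst c) \<and>
        homeomorphism (fst c) (snd c ` fst c) (snd c) (chart_inv c)) \<and>
     (\<forall>c\<in>A. \<forall>c'\<in>A. smooth_on (snd c ` (fst c \<inter> fst c')) (transition c c'))"

text \<open>A tangent vector at \<open>x\<close> is the family of its coordinate vectors with respect to all charts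
  around \<open>x\<close>, subject to the usual transformation law. At the other indices the family is set to
  \<open>0\<close>, so that equality of tangent vectors is equality of functions.\<close>

type_synonym ('a, 'e) tvec = "('a, 'e) chart \<Rightarrow> 'e"

definition tangent_space ::
  "('a, 'e::euclidean_space) chart set \<Rightarrow> 'a \<Rightarrow> ('a, 'e) tvec set" where
  "tangent_space A x =
     {v. (\<forall>c\<in>charts_at A x. \<forall>c'\<in>charts_at A x.
            v c' = frechet_derivative (transition c c') (at (snd c x)) (v c)) \<and>
         (\<forall>c. c \<notin> charts_at A x \<longrightarrow> v c = 0)}"

definition tadd :: "('a, 'e::euclidean_space) tvec \<Rightarrow> ('a, 'e) tvec \<Rightarrow> ('a, 'e) tvec" where
  "tadd v w = (\<lambda>c. v c + w c)"

definition tscale :: "real \<Rightarrow> ('a, 'e::euclidean_space) tvec \<Rightarrow> ('a, 'e) tvec" where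
  "tscale r v = (\<lambda>c. r *\<^sub>R v c)"

text \<open>The tangent vector at \<open>x\<close> whose coordinate vector in the chart \<open>c\<close> is \<open>a\<close>.\<close>

definition coord_tvec ::
  "('a, 'e::euclidean_space) chart set \<Rightarrow> ('a, 'e) chart \<Rightarrow> 'a \<Rightarrow> 'e \<Rightarrow> ('a, 'e) tvec" where
  "coord_tvec A c x a =
     (\<lambda>c'. if c' \<in> charts_at A x
           then frechet_derivative (transition c c') (at (snd c x)) a else 0)"

text \<open>The velocity at parameter \<open>t\<close> of a curve defined on \<open>S\<close> (one-sided at an endpoint of \<open>S\<close>).\<close>

definition velocity ::
  "('a, 'e::euclidean_space) chart set \<Rightarrow> real set \<Rightarrow> (real \<Rightarrow> 'a) \<Rightarrow> real \<Rightarrow> ('a, 'e) tvec" where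
  "velocity A S \<gamma> t =
     (\<lambda>c. if c \<in> charts_at A (\<gamma> t)
          then vector_derivative (snd c \<circ> \<gamma>) (at t within S) else 0)"

definition mfd_differentiable_at ::
  "('a, 'e::euclidean_space) chart set \<Rightarrow> ('a \<Rightarrow> real) \<Rightarrow> 'a \<Rightarrow> bool" where
  "mfd_differentiable_at A f x \<longleftrightarrow>
     (\<forall>c\<in>charts_at A x. (f \<circ> chart_inv c) differentiable (at (snd c x)))"


section \<open>Riemannian metrics, length and distance\<close>

type_synonym ('a, 'e) rmetric = "'a \<Rightarrow> ('a, 'e) tvec \<Rightarrow> ('a, 'e) tvec \<Rightarrow> real"

text \<open>The Gram form of the metric in the coordinates of \<open>c\<close>, at the coordinate point \<open>p\<close>.\<close>

definition chart_metric ::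
  "('a, 'e::euclidean_space) chart set \<Rightarrow> ('a, 'e) rmetric \<Rightarrow> ('a, 'e) chart \<Rightarrow> 'e \<Rightarrow> 'e \<Rightarrow> 'e \<Rightarrow> real"
  where
  "chart_metric A G c p a b =
     G (chart_inv c p) (coord_tvec A c (chart_inv c p) a) (coord_tvec A c (chart_inv c p) b)"

definition inner_product_on :: "('a, 'e::euclidean_space) tvec set \<Rightarrow>
    (('a, 'e) tvec \<Rightarrow> ('a, 'e) tvec \<Rightarrow> real) \<Rightarrow> bool" where
  "inner_product_on T g \<longleftrightarrow>
     (\<forall>u\<in>T. \<forall>v\<in>T. g u v = g v u) \<and>
     (\<forall>u\<in>T. \<forall>v\<in>T. \<forall>w\<in>T. g (tadd u v) w = g u w + g v w) \<and>
     (\<forall>u\<in>T. \<forall>v\<in>T. \<forall>r. g (tscale r u) v = r * g u v) \<and>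
     (\<forall>u\<in>T. u \<noteq> (\<lambda>c. 0) \<longrightarrow> 0 < g u u)"

definition riemannian_metric ::
  "('a, 'e::euclidean_space) chart set \<Rightarrow> ('a, 'e) rmetric \<Rightarrow> bool" where
  "riemannian_metric A G \<longleftrightarrow>
     (\<forall>x. inner_product_on (tangent_space A x) (G x)) \<and>
     (\<forall>c\<in>A. \<forall>a b. smooth_on (snd c ` fst c) (\<lambda>p. chart_metric A G c p a b))"

definition tnorm :: "('a, 'e::euclidean_space) rmetric \<Rightarrow> 'a \<Rightarrow> ('a, 'e) tvec \<Rightarrow> real" where
  "tnorm G x v = sqrt (G x v v)"

definition C1_curve_on ::
  "('a::topological_space, 'e::euclidean_space) chart set \<Rightarrow> real \<Rightarrow> real \<Rightarrow> (real \<Rightarrow> 'a) \<Rightarrow> bool" where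
  "C1_curve_on A a b \<gamma> \<longleftrightarrow>
     continuous_on {a..b} \<gamma> \<and>
     (\<forall>t\<in>{a..b}. \<forall>c\<in>charts_at A (\<gamma> t).
        (snd c \<circ> \<gamma>) differentiable (at t within {a..b}) \<and>
        continuous (at t within {a..b})
          (\<lambda>s. vector_derivative (snd c \<circ> \<gamma>) (at s within {a..b})))"

definition piecewise_C1_curve_on ::
  "('a::topological_space, 'e::euclidean_space) chart set \<Rightarrow> real \<Rightarrow> real \<Rightarrow> (real \<Rightarrow> 'a) \<Rightarrow> bool" where
  "piecewise_C1_curve_on A a b \<gamma> \<longleftrightarrow>
     (\<exists>(n::nat) \<tau>. \<tau> 0 = a \<and> \<tau> n = b \<and>
        (\<forall>i<n. \<tau> i < \<tau> (Suc i) \<and> C1_curve_on A (\<tau> i) (\<tau> (Suc i)) \<gamma>))"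

definition curve_length ::
  "('a, 'e::euclidean_space) chart set \<Rightarrow> ('a, 'e) rmetric \<Rightarrow> real \<Rightarrow> real \<Rightarrow> (real \<Rightarrow> 'a) \<Rightarrow> real" where
  "curve_length A G a b \<gamma> = integral {a..b} (\<lambda>t. tnorm G (\<gamma> t) (velocity A {a..b} \<gamma> t))"

definition riem_dist :: "('a::topological_space, 'e::euclidean_space) chart set \<Rightarrow>
    ('a, 'e) rmetric \<Rightarrow> 'a \<Rightarrow> 'a \<Rightarrow> real" where
  "riem_dist A G x y =
     Inf {curve_length A G 0 1 \<gamma> | \<gamma>. piecewise_C1_curve_on A 0 1 \<gamma> \<and> \<gamma> 0 = x \<and> \<gamma> 1 = y}"

definition riem_diameter :: "('a::topological_space, 'e::euclidean_space) chart set \<Rightarrow>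
    ('a, 'e) rmetric \<Rightarrow> 'a set \<Rightarrow> real" where
  "riem_diameter A G X = Sup {riem_dist A G x y | x y. x \<in> X \<and> y \<in> X}"

definition complete_connected_riemannian_manifold ::
  "('a::{t2_space, second_countable_topology}, 'e::euclidean_space) chart set \<Rightarrow>
    ('a, 'e) rmetric \<Rightarrow> bool" where
  "complete_connected_riemannian_manifold A G \<longleftrightarrow>
     smooth_atlas A \<and> riemannian_metric A G \<and>
     connected (UNIV :: 'a set) \<and> Metric_space.mcomplete UNIV (riem_dist A G)"


section \<open>Geodesics, exponential map and gradient\<close>

text \<open>The Levi-Civita connection in the coordinates of \<open>c\<close>: \<open>christoffel A G c p a b\<close> is the vector
  \<open>\<Sum>k. (\<Sum>i j. \<Gamma>\<^sup>k\<^sub>i\<^sub>j a\<^sup>i b\<^sup>j) e\<^sub>k\<close>, characterised by the Koszul formula for constant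
  coordinate fields.\<close>

definition christoffel ::
  "('a, 'e::euclidean_space) chart set \<Rightarrow> ('a, 'e) rmetric \<Rightarrow> ('a, 'e) chart \<Rightarrow> 'e \<Rightarrow> 'e \<Rightarrow> 'e \<Rightarrow> 'e" where
  "christoffel A G c p a b =
     (THE u. \<forall>w. chart_metric A G c p u w =
        (frechet_derivative (\<lambda>q. chart_metric A G c q b w) (at p) a
         + frechet_derivative (\<lambda>q. chart_metric A G c q a w) (at p) b
         - frechet_derivative (\<lambda>q. chart_metric A G c q a b) (at p) w) / 2)"

text \<open>The geodesic equation \<open>x'' + \<Gamma>\<^sub>x(x', x') = 0\<close> in all charts, for a curve on an interval \<open>S\<close>.\<close>

definition geodesic_on :: "('a::topological_space, 'e::euclidean_space) chart set \<Rightarrow>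
    ('a, 'e) rmetric \<Rightarrow> real set \<Rightarrow> (real \<Rightarrow> 'a) \<Rightarrow> bool" where
  "geodesic_on A G S \<gamma> \<longleftrightarrow>
     continuous_on S \<gamma> \<and>
     (\<forall>t\<in>S. \<forall>c\<in>charts_at A (\<gamma> t).
        \<exists>v a. ((snd c \<circ> \<gamma>) has_vector_derivative v) (at t within S) \<and>
              ((\<lambda>s. vector_derivative (snd c \<circ> \<gamma>) (at s within S)) has_vector_derivative a)
                (at t within S) \<and>
              a + christoffel A G c (snd c (\<gamma> t)) v v = 0)"

definition riem_exp :: "('a::topological_space, 'e::euclidean_space) chart set \<Rightarrow>
    ('a, 'e) rmetric \<Rightarrow> 'a \<Rightarrow> ('a, 'e) tvec \<Rightarrow> 'a" where
  "riem_exp A G x v =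
     (THE y. \<exists>\<gamma>. geodesic_on A G {0..1} \<gamma> \<and> \<gamma> 0 = x \<and> velocity A {0..1} \<gamma> 0 = v \<and> \<gamma> 1 = y)"

text \<open>The Riesz representative of the differential of \<open>f\<close> at \<open>x\<close>.\<close>

definition riem_grad :: "('a, 'e::euclidean_space) chart set \<Rightarrow> ('a, 'e) rmetric \<Rightarrow>
    ('a \<Rightarrow> real) \<Rightarrow> 'a \<Rightarrow> ('a, 'e) tvec" where
  "riem_grad A G f x =
     (THE w. w \<in> tangent_space A x \<and>
        (\<forall>v\<in>tangent_space A x. \<forall>c\<in>charts_at A x.
           G x w v = frechet_derivative (f \<circ> chart_inv c) (at (snd c x)) (v c)))"


section \<open>The constraint set, the oracle and the standing assumptions\<close>

definition weakly_min_geodesically_convex ::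
  "('a::topological_space, 'e::euclidean_space) chart set \<Rightarrow> ('a, 'e) rmetric \<Rightarrow> 'a set \<Rightarrow> bool" where
  "weakly_min_geodesically_convex A G X \<longleftrightarrow>
     (\<forall>x\<in>X. \<forall>y\<in>X. \<exists>\<gamma>. geodesic_on A G {0..1} \<gamma> \<and> \<gamma> 0 = x \<and> \<gamma> 1 = y \<and>
        curve_length A G 0 1 \<gamma> = riem_dist A G x y \<and> \<gamma> ` {0..1} \<subseteq> X)"

definition feasible_velocities :: "('a::topological_space, 'e::euclidean_space) chart set \<Rightarrow>
    ('a, 'e) rmetric \<Rightarrow> 'a set \<Rightarrow> 'a \<Rightarrow> ('a, 'e) tvec set" where
  "feasible_velocities A G X x =
     {v \<in> tangent_space A x.
        riem_exp A G x v \<in> X \<and>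
        tnorm G x v = riem_dist A G x (riem_exp A G x v) \<and>
        (\<forall>t\<in>{0..1}. riem_exp A G x (tscale t v) \<in> X)}"

definition regularity_assumption :: "('a::topological_space, 'e::euclidean_space) chart set \<Rightarrow>
    ('a, 'e) rmetric \<Rightarrow> 'a set \<Rightarrow> ('a \<Rightarrow> real) \<Rightarrow> real \<Rightarrow> bool" where
  "regularity_assumption A G X f L \<longleftrightarrow>
     (\<forall>x\<in>X. \<forall>v\<in>feasible_velocities A G X x. \<forall>t\<in>{0..1}.
        f (riem_exp A G x (tscale t v)) \<le> (1 - t) * f x + t * f (riem_exp A G x v) \<and>
        f (riem_exp A G x (tscale t v))
          \<le> f x + t * G x (riem_grad A G f x) v + L / 2 * t\<^sup>2 * (tnorm G x v)\<^sup>2)"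

definition oracle_solutions :: "('a::topological_space, 'e::euclidean_space) chart set \<Rightarrow>
    ('a, 'e) rmetric \<Rightarrow> 'a set \<Rightarrow> ('a \<Rightarrow> real) \<Rightarrow> 'a \<Rightarrow> ('a, 'e) tvec set" where
  "oracle_solutions A G X f x =
     {v. is_arg_min (\<lambda>u. G x (riem_grad A G f x) u) (\<lambda>u. u \<in> feasible_velocities A G X x) v}"

text \<open>\<open>Min\<close> of the library is for finite sets; \<open>Least\<close> gives the minimum of an arbitrary set of
  reals that has one.\<close>

definition oracle_gap :: "('a::topological_space, 'e::euclidean_space) chart set \<Rightarrow>
    ('a, 'e) rmetric \<Rightarrow> 'a set \<Rightarrow> ('a \<Rightarrow> real) \<Rightarrow> 'a \<Rightarrow> real" where
  "oracle_gap A G X f x =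
     - (LEAST r. r \<in> (\<lambda>v. G x (riem_grad A G f x) v) ` feasible_velocities A G X x)"

definition riemannian_scaling_inequality ::
  "('a::topological_space, 'e::euclidean_space) chart set \<Rightarrow> ('a, 'e) rmetric \<Rightarrow> 'a set \<Rightarrow> real \<Rightarrow> bool"
  where
  "riemannian_scaling_inequality A G X \<alpha> \<longleftrightarrow>
     (\<forall>x\<in>X. \<forall>w\<in>tangent_space A x. \<forall>v.
        is_arg_max (\<lambda>u. G x w u) (\<lambda>u. u \<in> feasible_velocities A G X x) v \<longrightarrow>
        G x w v \<ge> \<alpha> * tnorm G x w * (tnorm G x v)\<^sup>2)"

end

theory Submission
  imports Defs
begin

text \<open>An oracle solution \<open>v\<close> maximises the pairing with \<open>w = - grad f(x)\<close> over the feasible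
  velocities, so the scaling inequality for \<open>w\<close> is exactly the lower bound on the gap. With it, the
  quadratic term \<open>L/2 \<eta>\<^sup>2 \<parallel>v\<parallel>\<^sup>2\<close> of the regularity assumption is absorbed into the gap. To apply the
  scaling inequality, \<open>grad f(x)\<close>, given by a definite description, must be a tangent vector: this
  is the Riesz representation theorem on the tangent space, which a chart identifies with the
  model space.\<close>

section \<open>Inner products and Riesz representation\<close>

lemma inner_product_on_minus:
  assumes "inner_product_on T g" "u \<in> T" "v \<in> T"
  shows "g (tscale (-1) u) v = - g u v"
  using assms by (simp add: inner_product_on_def)

lemma inner_product_on_minus_minus:
  assumes ip: "inner_product_on T g" and u: "u \<in> T" and mu: "tscale (-1) u \<in> T"
  shows "g (tscale (-1) u) (tscale (-1) u) = g u u"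
proof -
  have "g (tscale (-1) u) (tscale (-1) u) = - g u (tscale (-1) u)"
    by (rule inner_product_on_minus[OF ip u mu])
  also have "g u (tscale (-1) u) = g (tscale (-1) u) u"
    using ip u mu by (simp add: inner_product_on_def)
  finally show ?thesis
    using inner_product_on_minus[OF ip u u] by simp
qed

lemma inner_product_on_nonneg:
  assumes ip: "inner_product_on T g" and u: "u \<in> T"
  shows "0 \<le> g u u"
proof (cases "u = (\<lambda>c. 0)")
  case True
  \<comment> \<open>Strict positivity is stated for nonzero vectors only; for the zero vector,
    homogeneity with factor 0 gives the value.\<close>
  have "g (tscale 0 u) u = 0"
    using ip u by (simp add: inner_product_on_def)
  then show ?thesis
    using True by (simp add: tscale_def)
next
  case False
  then show ?thesis
    using ip u by (force simp: inner_product_on_def)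
qed

text \<open>The map \<open>T\<close> sends \<open>p\<close> to the vector representing
  \<open>b p\<close> in the standard inner product. Positivity makes it injective, hence surjective
  in finite dimension, and a preimage of the vector representing \<open>l\<close> is the required
  \<open>p\<close>.\<close>

lemma riesz_bilinear_form:
  fixes b :: "'e::euclidean_space \<Rightarrow> 'e \<Rightarrow> real" and l :: "'e \<Rightarrow> real"
  assumes b1: "\<And>q. linear (\<lambda>p. b p q)" and b2: "\<And>p. linear (b p)"
    and pos: "\<And>p. p \<noteq> 0 \<Longrightarrow> 0 < b p p" and l: "linear l"
  shows "\<exists>p. \<forall>q. b p q = l q"
proof -
  define T where "T p = (\<Sum>i\<in>Basis. b p i *\<^sub>R i)" for p
  have T_inner: "T p \<bullet> i = b p i" if "i \<in> Basis" for p i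
    using that by (simp add: T_def)
  have T: "linear T"
    unfolding T_def
    by (intro linearI) (simp_all add: linear_add[OF b1] linear_cmul[OF b1]
        scaleR_left_distrib sum.distrib scaleR_sum_right)
  have "p = 0" if "T p = 0" for p
  proof -
    have "b p q = 0" if "q \<in> Basis" for q
      using T_inner[OF that, of p] \<open>T p = 0\<close> by simp
    then have "b p = (\<lambda>q. 0)"
      by (intro linear_eq_stdbasis b2 module_hom_zero) auto
    then show "p = 0"
      using pos[of p] by force
  qed
  then have "surj T"
    using T linear_injective_0 linear_injective_imp_surjective by blast
  then obtain p where p: "T p = (\<Sum>i\<in>Basis. l i *\<^sub>R i)"
    by (metis surjD)
  have "b p = l"
  proof (rule linear_eq_stdbasis[OF b2 l])
    fix i :: 'e assume "i \<in> Basis"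
    then show "b p i = l i"
      using T_inner[of i p] p by simp
  qed
  then show ?thesis by auto
qed

section \<open>Charts and derivatives of transition maps\<close>

lemma chart_inv_inverse:
  assumes "smooth_atlas A" "c \<in> A" "y \<in> fst c"
  shows "chart_inv c (snd c y) = y"
  using assms by (meson homeomorphism_apply1 smooth_atlas_def)

text \<open>A homeomorphism maps the relatively open part \<open>fst c \<inter> W\<close> to a
  relatively open subset of the coordinate domain, which is itself open. Such images serve as the
  neighborhoods on which maps in coordinates are compared.\<close>

lemma open_chart_image_Int:
  assumes A: "smooth_atlas A" and c: "c \<in> A" and W: "open W"
  shows "open (snd c ` (fst c \<inter> W))"
proof -
  have *: "open (fst c)" "open (snd c ` fst c)"
    "homeomorphism (fst c) (snd c ` fst c) (snd c) (chart_inv c)"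
    using A c by (auto simp: smooth_atlas_def)
  have "openin (top_of_set (snd c ` fst c)) (snd c ` (fst c \<inter> W))"
    using * W by (intro homeomorphism_imp_open_map[OF *(3)]) auto
  then show ?thesis
    using *(2) openin_open_eq by blast
qed

lemma transition_has_derivative:
  assumes A: "smooth_atlas A" and c: "c \<in> charts_at A x" "c' \<in> charts_at A x"
  shows "(transition c c' has_derivative frechet_derivative (transition c c') (at (snd c x)))
           (at (snd c x))"
proof -
  \<comment> \<open>Order 0 of smoothness gives continuity only; differentiability at each point is
    contained in order 1.\<close>
  have "C_k_on (Suc 0) (snd c ` (fst c \<inter> fst c')) (transition c c')"
    using A c unfolding smooth_atlas_def smooth_on_def charts_at_def by blast
  then have "transition c c' differentiable (at (snd c x))"
    using c by (auto simp: charts_at_def)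
  then show ?thesis
    by (simp add: frechet_derivative_works)
qed

lemma transition_apply:
  assumes "smooth_atlas A" "c \<in> charts_at A x"
  shows "transition c c' (snd c x) = snd c' x"
  using assms by (simp add: transition_def charts_at_def chart_inv_inverse)

text \<open>Taking \<open>F\<close> to be a coordinate map gives the cocycle identity for transition maps; taking
  it to be a function on the manifold shows that its differential does not depend on the chart.\<close>

lemma frechet_derivative_chart_change:
  fixes F :: "'a::{t2_space, second_countable_topology} \<Rightarrow> 'b::real_normed_vector"
  assumes A: "smooth_atlas A" and c: "c \<in> charts_at A x" and c': "c' \<in> charts_at A x"
    and F: "(F \<circ> chart_inv c') differentiable (at (snd c' x))"
  shows "frechet_derivative (F \<circ> chart_inv c) (at (snd c x)) =
         frechet_derivative (F \<circ> chart_inv c') (at (snd c' x)) \<circ>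
         frechet_derivative (transition c c') (at (snd c x))"
proof -
  let ?D = "frechet_derivative (F \<circ> chart_inv c') (at (snd c' x)) \<circ>
            frechet_derivative (transition c c') (at (snd c x))"
  have cA: "c \<in> A" "x \<in> fst c" "c' \<in> A" "x \<in> fst c'"
    using c c' by (auto simp: charts_at_def)
  have "(F \<circ> chart_inv c' has_derivative
          frechet_derivative (F \<circ> chart_inv c') (at (snd c' x))) (at (transition c c' (snd c x)))"
    using F transition_apply[OF A c] by (simp add: frechet_derivative_works)
  then have D: "(F \<circ> chart_inv c' \<circ> transition c c' has_derivative ?D) (at (snd c x))"
    by (intro diff_chain_at transition_has_derivative[OF A c c'])
  \<comment> \<open>The two functions are known to agree only on the image of the overlap of the
    charts. Its openness lets the derivative pass from one to the other.\<close>
  have "open (fst c')"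
    using A cA by (auto simp: smooth_atlas_def)
  then have "open (snd c ` (fst c \<inter> fst c'))"
    by (rule open_chart_image_Int[OF A cA(1)])
  then have "(F \<circ> chart_inv c has_derivative ?D) (at (snd c x))"
  proof (rule has_derivative_transform_within_open[OF D])
    show "snd c x \<in> snd c ` (fst c \<inter> fst c')"
      using cA by blast
    fix p assume "p \<in> snd c ` (fst c \<inter> fst c')"
    then show "(F \<circ> chart_inv c' \<circ> transition c c') p = (F \<circ> chart_inv c) p"
      using cA by (auto simp: transition_def chart_inv_inverse[OF A])
  qed
  then show ?thesis
    by (metis frechet_derivative_at)
qed

text \<open>Off the image of the chart the value of \<open>chart_inv c\<close> is arbitrary, so
  \<open>transition c c\<close> is the identity only on that image; being open, the image determines
  the derivative.\<close>

lemma frechet_derivative_transition_self: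
  assumes A: "smooth_atlas A" and c: "c \<in> charts_at A x"
  shows "frechet_derivative (transition c c) (at (snd c x)) = (\<lambda>a. a)"
proof -
  have cA: "c \<in> A" "x \<in> fst c"
    using c by (auto simp: charts_at_def)
  have "open (snd c ` (fst c \<inter> UNIV))"
    by (rule open_chart_image_Int[OF A cA(1) open_UNIV])
  then have "(transition c c has_derivative (\<lambda>a. a)) (at (snd c x))"
  proof (rule has_derivative_transform_within_open[OF has_derivative_ident])
    show "snd c x \<in> snd c ` (fst c \<inter> UNIV)"
      using cA by blast
    fix p assume "p \<in> snd c ` (fst c \<inter> UNIV)"
    then show "p = transition c c p"
      using cA by (auto simp: transition_def chart_inv_inverse[OF A])
  qed
  then show ?thesis
    by (metis frechet_derivative_at)
qed

lemma linear_frechet_derivative_transition: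
  assumes "smooth_atlas A" "c \<in> charts_at A x" "c' \<in> charts_at A x"
  shows "linear (frechet_derivative (transition c c') (at (snd c x)))"
  using transition_has_derivative[OF assms] by (rule has_derivative_linear)

section \<open>Tangent spaces and their coordinates\<close>

lemma tangent_space_transition:
  assumes "v \<in> tangent_space A x" "c \<in> charts_at A x" "c' \<in> charts_at A x"
  shows "frechet_derivative (transition c c') (at (snd c x)) (v c) = v c'"
  using assms unfolding tangent_space_def mem_Collect_eq by metis

lemma tangent_space_outside:
  assumes "v \<in> tangent_space A x" "c \<notin> charts_at A x"
  shows "v c = 0"
  using assms unfolding tangent_space_def by blast

lemma tadd_in_tangent_space:
  assumes "smooth_atlas A" "u \<in> tangent_space A x" "v \<in> tangent_space A x"
  shows "tadd u v \<in> tangent_space A x"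
  unfolding tangent_space_def[of A x] tadd_def
  using assms
  by (auto simp: linear_add[OF linear_frechet_derivative_transition[OF assms(1)]]
      tangent_space_transition tangent_space_outside)

lemma tscale_in_tangent_space:
  assumes "smooth_atlas A" "v \<in> tangent_space A x"
  shows "tscale r v \<in> tangent_space A x"
  unfolding tangent_space_def[of A x] tscale_def
  using assms
  by (auto simp: linear_cmul[OF linear_frechet_derivative_transition[OF assms(1)]]
      tangent_space_transition tangent_space_outside)

text \<open>The transformation law from \<open>c1\<close> to \<open>c2\<close> is the cocycle
  identity for the charts \<open>c\<close>, \<open>c1\<close>, \<open>c2\<close>: the change of
  chart with \<open>snd c2\<close> as the function.\<close>

lemma coord_tvec_in_tangent_space:
  assumes A: "smooth_atlas A" and c: "c \<in> charts_at A x"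
  shows "coord_tvec A c x a \<in> tangent_space A x"
  unfolding tangent_space_def mem_Collect_eq
proof (intro conjI ballI allI impI)
  fix c1 c2 assume c1: "c1 \<in> charts_at A x" and c2: "c2 \<in> charts_at A x"
  have "(snd c2 \<circ> chart_inv c1) differentiable (at (snd c1 x))"
    using transition_has_derivative[OF A c1 c2] by (auto simp: transition_def differentiable_def)
  from frechet_derivative_chart_change[OF A c c1 this]
  have "frechet_derivative (transition c c2) (at (snd c x)) a =
        frechet_derivative (transition c1 c2) (at (snd c1 x))
          (frechet_derivative (transition c c1) (at (snd c x)) a)"
    by (simp add: transition_def)
  then show "coord_tvec A c x a c2 =
        frechet_derivative (transition c1 c2) (at (snd c1 x)) (coord_tvec A c x a c1)"
    using c1 c2 by (simp add: coord_tvec_def)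
qed (simp add: coord_tvec_def)

text \<open>With \<open>coord_tvec_of_tangent\<close>, this makes \<open>coord_tvec A c x\<close>
  and evaluation at \<open>c\<close> mutually inverse between the model space and the tangent
  space.\<close>

lemma coord_tvec_at_chart:
  assumes "smooth_atlas A" "c \<in> charts_at A x"
  shows "coord_tvec A c x a c = a"
  using assms by (simp add: coord_tvec_def frechet_derivative_transition_self)

lemma coord_tvec_of_tangent:
  assumes "v \<in> tangent_space A x" "c \<in> charts_at A x"
  shows "coord_tvec A c x (v c) = v"
  using assms by (auto simp: coord_tvec_def tangent_space_transition tangent_space_outside)

lemma coord_tvec_add:
  assumes "smooth_atlas A" "c \<in> charts_at A x"
  shows "coord_tvec A c x (a + b) = tadd (coord_tvec A c x a) (coord_tvec A c x b)"
  using linear_frechet_derivative_transition[OF assms]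
  by (auto simp: coord_tvec_def tadd_def linear_add)

lemma coord_tvec_scale:
  assumes "smooth_atlas A" "c \<in> charts_at A x"
  shows "coord_tvec A c x (r *\<^sub>R a) = tscale r (coord_tvec A c x a)"
  using linear_frechet_derivative_transition[OF assms]
  by (auto simp: coord_tvec_def tscale_def linear_cmul)

text \<open>The difference \<open>d\<close> of the two vectors pairs to zero with itself, against
  positive definiteness. This yields uniqueness of the gradient.\<close>

lemma tangent_space_nondegenerate:
  assumes A: "smooth_atlas A" and ip: "inner_product_on (tangent_space A x) g"
    and w: "w \<in> tangent_space A x" "w' \<in> tangent_space A x"
    and eq: "\<And>v. v \<in> tangent_space A x \<Longrightarrow> g w v = g w' v"
  shows "w = w'"
proof (rule ccontr)
  assume "w \<noteq> w'"
  define d where "d = tadd w (tscale (-1) w')"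
  have mw': "tscale (-1) w' \<in> tangent_space A x"
    by (rule tscale_in_tangent_space[OF A w(2)])
  then have d: "d \<in> tangent_space A x"
    unfolding d_def by (rule tadd_in_tangent_space[OF A w(1)])
  have "g d d = g w d + g (tscale (-1) w') d"
    using ip w(1) mw' d unfolding inner_product_on_def d_def by blast
  also have "\<dots> = 0"
    using inner_product_on_minus[OF ip w(2) d] eq[OF d] by simp
  finally have "g d d = 0" .
  moreover have "d \<noteq> (\<lambda>c. 0)"
    using \<open>w \<noteq> w'\<close> by (auto simp: d_def tadd_def tscale_def fun_eq_iff)
  then have "0 < g d d"
    using ip d unfolding inner_product_on_def by blast
  ultimately show False
    by simp
qed

section \<open>The Riemannian gradient\<close>

lemma riem_grad_in_tangent_space:
  assumes A: "smooth_atlas A" and ip: "inner_product_on (tangent_space A x) (G x)"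
    and f: "mfd_differentiable_at A f x"
  shows "riem_grad A G f x \<in> tangent_space A x"
proof -
  let ?T = "tangent_space A x"
  have "\<Union> (fst ` A) = UNIV"
    using A by (simp add: smooth_atlas_def)
  then obtain c where c: "c \<in> charts_at A x"
    unfolding charts_at_def by blast
  define e where "e = coord_tvec A c x"
  have eT: "e a \<in> ?T" for a
    unfolding e_def by (rule coord_tvec_in_tangent_space[OF A c])
  have e_add: "e (a + b) = tadd (e a) (e b)" and e_scale: "e (r *\<^sub>R a) = tscale r (e a)" for a b r
    unfolding e_def by (rule coord_tvec_add[OF A c] coord_tvec_scale[OF A c])+
  have sym: "G x (e a) (e b) = G x (e b) (e a)" for a b
    using ip eT by (simp add: inner_product_on_def)
  have lin1: "linear (\<lambda>a. G x (e a) (e b))" for b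
    using ip eT by (intro linearI) (simp_all add: e_add e_scale inner_product_on_def)
  \<comment> \<open>The axioms give linearity in the first argument; symmetry transfers it to the
    second.\<close>
  have lin2: "linear (\<lambda>b. G x (e a) (e b))" for a
    using lin1[of a] by (simp add: sym[of a])
  have pos: "0 < G x (e a) (e a)" if "a \<noteq> 0" for a
  proof -
    have "e a c \<noteq> 0"
      using that by (simp add: e_def coord_tvec_at_chart[OF A c])
    then have "e a \<noteq> (\<lambda>c. 0)"
      by auto
    then show ?thesis
      using ip eT by (simp add: inner_product_on_def)
  qed
  have fd: "(f \<circ> chart_inv c') differentiable (at (snd c' x))" if "c' \<in> charts_at A x" for c'
    using f that by (simp add: mfd_differentiable_at_def)
  let ?df = "\<lambda>c'. frechet_derivative (f \<circ> chart_inv c') (at (snd c' x))"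
  have "linear (?df c)"
    by (rule linear_frechet_derivative[OF fd[OF c]])
  then obtain p where p: "\<And>q. G x (e p) (e q) = ?df c q"
    using riesz_bilinear_form[of "\<lambda>a b. G x (e a) (e b)", OF lin1 lin2 pos] by blast
  define P where "P w \<longleftrightarrow> w \<in> ?T \<and> (\<forall>v\<in>?T. \<forall>c'\<in>charts_at A x. G x w v = ?df c' (v c'))" for w
  \<comment> \<open>Riesz representation handles the single chart \<open>c\<close>; invariance of
    the differential under change of chart extends the identity to every chart at
    \<open>x\<close>.\<close>
  have "P (e p)"
    unfolding P_def
  proof (intro conjI ballI)
    fix v c' assume v: "v \<in> ?T" and c': "c' \<in> charts_at A x"
    have "G x (e p) v = ?df c (v c)"
      using p[of "v c"] coord_tvec_of_tangent[OF v c] by (simp add: e_def)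
    also have "\<dots> = ?df c' (frechet_derivative (transition c c') (at (snd c x)) (v c))"
      using frechet_derivative_chart_change[OF A c c' fd[OF c']] by simp
    also have "frechet_derivative (transition c c') (at (snd c x)) (v c) = v c'"
      by (rule tangent_space_transition[OF v c c'])
    finally show "G x (e p) v = ?df c' (v c')" .
  qed (rule eT)
  \<comment> \<open>Both vectors pair with \<open>v\<close> to the same number
    \<open>?df c (v c)\<close>, so nondegeneracy identifies them.\<close>
  moreover have "w = e p" if "P w" for w
    using that \<open>P (e p)\<close> c unfolding P_def
    by (intro tangent_space_nondegenerate[OF A ip]) auto
  ultimately have "P (THE w. P w)"
    by (rule theI)
  then show ?thesis
    by (simp add: riem_grad_def P_def)
qed

section \<open>The oracle gap and the scaling inequality\<close>

text \<open>\<open>LEAST\<close> over a set of reals is meaningful only if the minimum is attained;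
  the oracle solution attains it.\<close>

lemma oracle_gap_eq:
  assumes "v \<in> oracle_solutions A G X f x"
  shows "oracle_gap A G X f x = - G x (riem_grad A G f x) v"
proof -
  have "(LEAST r. r \<in> G x (riem_grad A G f x) ` feasible_velocities A G X x)
          = G x (riem_grad A G f x) v"
    using assms
    by (intro Least_equality) (auto simp: oracle_solutions_def is_arg_min_def not_less)
  then show ?thesis
    by (simp add: oracle_gap_def)
qed

lemma oracle_gap_ge_scaling:
  assumes A: "smooth_atlas A" and ip: "inner_product_on (tangent_space A x) (G x)"
    and RSI: "riemannian_scaling_inequality A G X \<alpha>" and x: "x \<in> X"
    and grad: "riem_grad A G f x \<in> tangent_space A x"
    and v: "v \<in> oracle_solutions A G X f x"
  shows "oracle_gap A G X f x \<ge> \<alpha> * tnorm G x (riem_grad A G f x) * (tnorm G x v)\<^sup>2"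
proof -
  define w where "w = tscale (-1) (riem_grad A G f x)"
  have w: "w \<in> tangent_space A x"
    unfolding w_def by (rule tscale_in_tangent_space[OF A grad])
  \<comment> \<open>The metric is bilinear on tangent vectors only, hence the restriction to
    feasible \<open>u\<close>. This sign change turns the minimization into a maximization.\<close>
  have Gw: "G x w u = - G x (riem_grad A G f x) u" if "u \<in> feasible_velocities A G X x" for u
    using that inner_product_on_minus[OF ip grad, of u]
    by (simp add: w_def feasible_velocities_def)
  have v_feas: "v \<in> feasible_velocities A G X x"
    using v by (simp add: oracle_solutions_def is_arg_min_def)
  have "is_arg_max (G x w) (\<lambda>u. u \<in> feasible_velocities A G X x) v"
    using v by (auto simp: oracle_solutions_def is_arg_min_def is_arg_max_def Gw)
  then have "\<alpha> * tnorm G x w * (tnorm G x v)\<^sup>2 \<le> G x w v"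
    using RSI x w unfolding riemannian_scaling_inequality_def by blast
  moreover have "tnorm G x w = tnorm G x (riem_grad A G f x)"
    using inner_product_on_minus_minus[OF ip grad] w by (simp add: tnorm_def w_def)
  ultimately show ?thesis
    using Gw[OF v_feas] oracle_gap_eq[OF v] by simp
qed

theorem proposition5p2:
  fixes A :: "('a::{t2_space, second_countable_topology}, 'e::euclidean_space) chart set"
    and G :: "('a, 'e) rmetric"
    and X U :: "'a set"
    and f :: "'a \<Rightarrow> real"
    and L \<alpha> \<nu> M_RSI :: real
  assumes manifold: "complete_connected_riemannian_manifold A G"
    and X_nonempty: "X \<noteq> {}"
    and X_compact: "compact X"
    and X_diameter: "riem_diameter A G X > 0"
    and X_convex: "weakly_min_geodesically_convex A G X"
    and U: "open U" "X \<subseteq> U"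
    and f_differentiable: "\<forall>x\<in>U. mfd_differentiable_at A f x"
    and L_pos: "L > 0"
    and regularity: "regularity_assumption A G X f L"
    and \<alpha>_pos: "\<alpha> > 0"
    and RSI: "riemannian_scaling_inequality A G X \<alpha>"
    and \<nu>_def: "\<nu> = (INF x\<in>X. tnorm G x (riem_grad A G f x))"
    and \<nu>_pos: "\<nu> > 0"
    and M_RSI_def: "M_RSI = L / (\<alpha> * \<nu>)"
  shows "\<forall>x\<in>X. \<forall>v\<in>oracle_solutions A G X f x. \<forall>\<eta>\<in>{0..1}.
           oracle_gap A G X f x \<ge> \<alpha> * \<nu> * (tnorm G x v)\<^sup>2 \<and>
           f (riem_exp A G x (tscale \<eta> v)) - f x - \<eta> * G x (riem_grad A G f x) v
             \<le> M_RSI / 2 * \<eta>\<^sup>2 * oracle_gap A G X f x"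
proof (intro ballI)
  fix x v \<eta>
  assume x: "x \<in> X" and v: "v \<in> oracle_solutions A G X f x" and \<eta>: "\<eta> \<in> {0..1::real}"
  let ?gap = "oracle_gap A G X f x"
  have A: "smooth_atlas A" and ip: "inner_product_on (tangent_space A y) (G y)" for y
    using manifold
    by (auto simp: complete_connected_riemannian_manifold_def riemannian_metric_def)
  have grad: "riem_grad A G f y \<in> tangent_space A y" if "y \<in> X" for y
    using that U(2) f_differentiable by (intro riem_grad_in_tangent_space[OF A ip]) auto
  \<comment> \<open>A real infimum is a lower bound only for a set bounded below; here 0 is a bound
    because the norms are nonnegative.\<close>
  have "bdd_below ((\<lambda>y. tnorm G y (riem_grad A G f y)) ` X)"
    using inner_product_on_nonneg[OF ip grad]
    by (intro bdd_belowI2[where m = 0]) (simp add: tnorm_def)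
  then have "\<nu> \<le> tnorm G x (riem_grad A G f x)"
    unfolding \<nu>_def using x by (rule cINF_lower)
  then have "\<alpha> * \<nu> * (tnorm G x v)\<^sup>2 \<le> \<alpha> * tnorm G x (riem_grad A G f x) * (tnorm G x v)\<^sup>2"
    using \<alpha>_pos by (intro mult_right_mono mult_left_mono) auto
  also have "\<dots> \<le> ?gap"
    by (rule oracle_gap_ge_scaling[OF A ip RSI x grad[OF x] v])
  finally have gap: "\<alpha> * \<nu> * (tnorm G x v)\<^sup>2 \<le> ?gap" .
  have "v \<in> feasible_velocities A G X x"
    using v by (simp add: oracle_solutions_def is_arg_min_def)
  then have "f (riem_exp A G x (tscale \<eta> v))
               \<le> f x + \<eta> * G x (riem_grad A G f x) v + L / 2 * \<eta>\<^sup>2 * (tnorm G x v)\<^sup>2"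
    using regularity x \<eta> unfolding regularity_assumption_def by blast
  \<comment> \<open>The constant is chosen so that \<open>M_RSI * (\<alpha> * \<nu>) = L\<close>,
    which exposes the lower bound on the gap as a factor.\<close>
  moreover have "L / 2 * \<eta>\<^sup>2 * (tnorm G x v)\<^sup>2 = M_RSI / 2 * \<eta>\<^sup>2 * (\<alpha> * \<nu> * (tnorm G x v)\<^sup>2)"
    using \<alpha>_pos \<nu>_pos by (simp add: M_RSI_def)
  moreover have "\<dots> \<le> M_RSI / 2 * \<eta>\<^sup>2 * ?gap"
    using gap \<alpha>_pos \<nu>_pos L_pos by (intro mult_left_mono) (simp_all add: M_RSI_def)
  ultimately show "?gap \<ge> \<alpha> * \<nu> * (tnorm G x v)\<^sup>2 \<and>
      f (riem_exp A G x (tscale \<eta> v)) - f x - \<eta> * G x (riem_grad A G f x) v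
        \<le> M_RSI / 2 * \<eta>\<^sup>2 * ?gap"
    using gap by linarith
qed

end
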